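(* Let $n\geq 3$. Then $\psi_{n-1}(C_n)=0$ if $n=3$, $\psi_{n-1}(C_n)=1$ if $n=4$, and $\psi_{n-1}(C_n)=\lfloor\frac n2\rfloor$ if $n\geq 5$.
   Context: $C_n$ is the cycle on $n$ vertices. Partitions are partitions of the vertex set of a graph into nonempty (unlabeled) cells. Two partitions of $V(G)$ are equivalent if some automorphism of $G$ maps one onto the other (mapping cells to cells). A distinguishing coloring partition of $G$ is a partition of $V(G)$ that induces a distinguishing coloring, i.e. only the identity automorphism of $G$ maps each cell onto itself. $\psi_k(G)$ is the number of non-equivalent distinguishing coloring partitions (equivalence classes) of $G$ with exactly $k$ cells. *)

theory Defs
  imports "HOL-Library.Disjoint_Sets" "HOL-Combinatorics.Permutations"
begin

text \<open>A graph is a pair of its vertex set and its edge set; every edge is the set of its two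
  endpoints.\<close>

type_synonym 'a graph = "'a set \<times> 'a set set"

abbreviation verts :: "'a graph \<Rightarrow> 'a set" where
  "verts \<equiv> fst"

abbreviation edges :: "'a graph \<Rightarrow> 'a set set" where
  "edges \<equiv> snd"

text \<open>For n at most 2 the definition degenerates; it is the cycle on n vertices for n at least 3.\<close>

definition cycle_graph :: "nat \<Rightarrow> nat graph" where
  "cycle_graph n = ({..<n}, (\<lambda>i. {i, (i + 1) mod n}) ` {..<n})"

text \<open>Automorphisms are extended by the identity outside the vertex set (this is part of
  \<open>permutes\<close>), so the identity automorphism is literally \<open>id\<close>.\<close>

definition automorphisms :: "'a graph \<Rightarrow> ('a \<Rightarrow> 'a) set" where
  "automorphisms G = {f. f permutes verts G \<and>
     (\<forall>u\<in>verts G. \<forall>v\<in>verts G. {f u, f v} \<in> edges G \<longleftrightarrow> {u, v} \<in> edges G)}"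

definition distinguishing_partition :: "'a graph \<Rightarrow> 'a set set \<Rightarrow> bool" where
  "distinguishing_partition G P \<longleftrightarrow> partition_on (verts G) P \<and>
     (\<forall>f\<in>automorphisms G. (\<forall>X\<in>P. f ` X = X) \<longrightarrow> f = id)"

definition distinguishing_partitions :: "'a graph \<Rightarrow> nat \<Rightarrow> 'a set set set" where
  "distinguishing_partitions G k = {P. distinguishing_partition G P \<and> finite P \<and> card P = k}"

definition partition_equiv :: "'a graph \<Rightarrow> ('a set set \<times> 'a set set) set" where
  "partition_equiv G = {(P, Q). partition_on (verts G) P \<and> partition_on (verts G) Q \<and>
     (\<exists>f\<in>automorphisms G. (\<lambda>X. f ` X) ` P = Q)}"

text \<open>The number of equivalence classes of distinguishing partitions with k cells.
  \<open>partition_equiv\<close> relates arbitrary partitions, hence the restriction to the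
  partitions that are counted.\<close>

definition psi :: "nat \<Rightarrow> 'a graph \<Rightarrow> nat" where
  "psi k G = card (distinguishing_partitions G k //
     Restr (partition_equiv G) (distinguishing_partitions G k))"

lemma id_in_automorphisms: "id \<in> automorphisms G"
  by (simp add: automorphisms_def permutes_id)

lemma inv_in_automorphisms:
  assumes "f \<in> automorphisms G"
  shows "inv f \<in> automorphisms G"
proof -
  have f: "f permutes verts G" using assms by (simp add: automorphisms_def)
  have "{inv f u, inv f v} \<in> edges G \<longleftrightarrow> {u, v} \<in> edges G"
    if "u \<in> verts G" "v \<in> verts G" for u v
  proof -
    have "inv f u \<in> verts G" "inv f v \<in> verts G"
      using that permutes_in_image[OF permutes_inv[OF f]] by auto
    then have "{f (inv f u), f (inv f v)} \<in> edges G \<longleftrightarrow> {inv f u, inv f v} \<in> edges G"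
      using assms by (simp add: automorphisms_def)
    then show ?thesis by (simp add: permutes_inverses(1)[OF f])
  qed
  then show ?thesis using permutes_inv[OF f] by (simp add: automorphisms_def)
qed

lemma comp_in_automorphisms:
  assumes "f \<in> automorphisms G" "g \<in> automorphisms G"
  shows "g \<circ> f \<in> automorphisms G"
  using assms by (auto simp: automorphisms_def permutes_compose permutes_in_image)

lemma equiv_partition_equiv: "equiv {P. partition_on (verts G) P} (partition_equiv G)"
proof (rule equivI)
  show "partition_equiv G \<subseteq> {P. partition_on (verts G) P} \<times> {P. partition_on (verts G) P}"
    by (auto simp: partition_equiv_def)
  show "refl_on {P. partition_on (verts G) P} (partition_equiv G)"
    using id_in_automorphisms[of G] by (auto simp: refl_on_def partition_equiv_def intro!: bexI[of _ id])
  show "sym (partition_equiv G)"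
  proof (rule symI)
    fix P Q assume "(P, Q) \<in> partition_equiv G"
    then obtain f where f: "f \<in> automorphisms G" "(\<lambda>X. f ` X) ` P = Q"
      and PQ: "partition_on (verts G) P" "partition_on (verts G) Q"
      by (auto simp: partition_equiv_def)
    have "inj f" using f(1) by (auto simp: automorphisms_def intro: permutes_inj)
    then have "(\<lambda>X. inv f ` X) ` Q = P"
      by (simp add: f(2)[symmetric] image_image)
    then show "(Q, P) \<in> partition_equiv G"
      using PQ inv_in_automorphisms[OF f(1)] by (auto simp: partition_equiv_def)
  qed
  show "trans (partition_equiv G)"
  proof (rule transI)
    fix P Q R assume "(P, Q) \<in> partition_equiv G" "(Q, R) \<in> partition_equiv G"
    then obtain f g where f: "f \<in> automorphisms G" "(\<lambda>X. f ` X) ` P = Q"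
      and g: "g \<in> automorphisms G" "(\<lambda>X. g ` X) ` Q = R"
      and PR: "partition_on (verts G) P" "partition_on (verts G) R"
      by (auto simp: partition_equiv_def)
    have "(\<lambda>X. (g \<circ> f) ` X) ` P = R"
      unfolding f(2)[symmetric] g(2)[symmetric] by (simp add: image_image image_comp)
    then show "(P, R) \<in> partition_equiv G"
      using PR comp_in_automorphisms[OF f(1) g(1)] unfolding partition_equiv_def by blast
  qed
qed

end

theory Submission
  imports Defs "HOL-Number_Theory.Cong"
begin

text \<open>
  Since the cells are nonempty, a partition of \<open>n\<close> vertices into \<open>n - 1\<close> cells has a single cell
  \<open>{a, b}\<close> with two vertices, and all its other cells are singletons. A permutation that maps each
  of these cells onto itself is the identity or the transposition of \<open>a\<close> and \<open>b\<close>. Hence the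
  partition is distinguishing precisely when that transposition is not an automorphism, that is, when
  \<open>a\<close> and \<open>b\<close> do not have the same neighbours apart from each other
  (\<open>distinguishing_pair_partition_iff\<close>). In a cycle such twins exist only if \<open>n = 3\<close>, where any two
  vertices are twins, or \<open>n = 4\<close>, where exactly the opposite vertices are.

  It remains to classify the pairs \<open>{a, b}\<close> up to automorphisms. Every automorphism of the cycle has
  the form \<open>i \<mapsto> c + i\<close> or \<open>i \<mapsto> c - i\<close> modulo \<open>n\<close> (\<open>automorphism_cycle_graph_affine\<close>), so it
  preserves the cyclic distance. Conversely, a rotation takes \<open>{0, d}\<close> to any given pair at cyclic
  distance \<open>d\<close>. The cyclic distance is thus a complete invariant (\<open>equiv_iff_cyclic_dist_eq\<close>), and
  the classes correspond to the distances that occur: all of \<open>1, \<dots>, n div 2\<close> if \<open>n \<ge> 5\<close>, only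
  \<open>1\<close> if \<open>n = 4\<close>, and none if \<open>n = 3\<close>.
\<close>

section \<open>Partitions with one cell fewer than there are points\<close>

definition pair_partition :: "'a set \<Rightarrow> 'a \<Rightarrow> 'a \<Rightarrow> 'a set set" where
  "pair_partition V a b = insert {a, b} ((\<lambda>x. {x}) ` (V - {a, b}))"

lemma pair_partition_commute: "pair_partition V a b = pair_partition V b a"
  by (simp add: pair_partition_def insert_commute)

lemma partition_on_pair_partition:
  assumes "a \<in> V" "b \<in> V"
  shows "partition_on V (pair_partition V a b)"
  using assms by (auto simp: pair_partition_def partition_on_def disjoint_def)

lemma card_pair_partition:
  assumes "finite V" "a \<in> V" "b \<in> V" "a \<noteq> b"
  shows "card (pair_partition V a b) = card V - 1"
proof -
  have "{a, b} \<notin> (\<lambda>x. {x}) ` (V - {a, b})" by auto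
  moreover have "card ((\<lambda>x. {x}) ` (V - {a, b})) = card V - 2"
    using assms by (subst card_image) (auto simp: inj_on_def card_Diff_subset)
  moreover have "card V \<ge> 2"
    using card_mono[of V "{a, b}"] assms by simp
  ultimately show ?thesis
    using assms by (simp add: pair_partition_def)
qed

text \<open>
  The excesses \<open>card X - 1\<close> of the cells add up to \<open>card V - card P = 1\<close>, so one cell has excess
  \<open>1\<close> and all others have excess \<open>0\<close>.
\<close>

lemma partition_with_one_cell_fewer:
  assumes V: "finite V" and P: "partition_on V P" and card: "card P + 1 = card V"
  obtains a b where "a \<in> V" "b \<in> V" "a \<noteq> b" "P = pair_partition V a b"
proof -
  have fin: "finite P" "\<And>X. X \<in> P \<Longrightarrow> finite X"
    using finite_elements[OF V P] V partition_onD1[OF P] by (blast intro: finite_subset)+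
  have pos: "card X \<ge> 1" if "X \<in> P" for X
  proof -
    have "X \<noteq> {}" using that partition_onD3[OF P] by blast
    then show ?thesis using fin(2)[OF that] by (simp add: Suc_le_eq card_gt_0_iff)
  qed
  have "(\<Sum>X\<in>P. (card X - 1) + 1) = (\<Sum>X\<in>P. card X)"
    using pos by (intro sum.cong) (simp_all del: One_nat_def)
  also have "\<dots> = card V"
    using product_partition[OF P fin(2)] by simp
  finally have "(\<Sum>X\<in>P. card X - 1) = 1"
    using card by (simp add: sum.distrib del: One_nat_def)
  then obtain Y where Y: "Y \<in> P" "card Y - 1 = 1"
      and others: "\<And>X. X \<in> P \<Longrightarrow> X \<noteq> Y \<Longrightarrow> card X - 1 = 0"
    unfolding sum_eq_1_iff[OF fin(1)] by blast
  from Y(2) have "card Y = 2" by linarith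
  then obtain a b where ab: "Y = {a, b}" "a \<noteq> b"
    by (auto simp: card_2_iff)
  have single: "\<exists>x. X = {x}" if "X \<in> P" "X \<noteq> Y" for X
  proof -
    have "card X = 1" using others[OF that] pos[OF that(1)] by linarith
    then show ?thesis by (auto simp: card_1_singleton_iff)
  qed
  have inV: "a \<in> V" "b \<in> V" using Y(1) ab partition_onD1[OF P] by auto
  have disj: "X \<inter> Y = {}" if "X \<in> P" "X \<noteq> Y" for X
    using that Y(1) partition_onD2[OF P] by (auto simp: disjoint_def)
  have "P = pair_partition V a b"
  proof
    show "P \<subseteq> pair_partition V a b"
    proof
      fix X assume X: "X \<in> P"
      show "X \<in> pair_partition V a b"
      proof (cases "X = Y")
        case True
        then show ?thesis by (simp add: pair_partition_def ab)
      next
        case False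
        then obtain x where x: "X = {x}" using single X by blast
        then have "x \<in> V" using X partition_onD1[OF P] by auto
        then show ?thesis using x disj[OF X False] by (auto simp: pair_partition_def ab)
      qed
    qed
    show "pair_partition V a b \<subseteq> P"
    proof
      fix X assume "X \<in> pair_partition V a b"
      then consider "X = Y" | x where "X = {x}" "x \<in> V" "x \<notin> Y"
        by (auto simp: pair_partition_def ab)
      then show "X \<in> P"
      proof cases
        case 1
        then show ?thesis using Y by simp
      next
        case 2
        then obtain Z where Z: "Z \<in> P" "x \<in> Z" using partition_onD1[OF P] by auto
        then obtain z where "Z = {z}" using single 2(3) by blast
        then show ?thesis using Z 2 by simp
      qed
    qed
  qed
  with inV ab show thesis using that by blast
qed

lemma image_pair_partition:
  assumes "f permutes V"
  shows "(\<lambda>X. f ` X) ` pair_partition V a b = pair_partition V (f a) (f b)"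
proof -
  have "(\<lambda>X. f ` X) ` pair_partition V a b = insert {f a, f b} ((\<lambda>x. {x}) ` f ` (V - {a, b}))"
    by (simp add: pair_partition_def image_image)
  also have "f ` (V - {a, b}) = V - {f a, f b}"
    by (simp add: image_set_diff permutes_inj[OF assms] permutes_image[OF assms])
  finally show ?thesis by (simp add: pair_partition_def)
qed

text \<open>
  The permutations that map each cell onto itself fix every vertex other than \<open>a\<close> and \<open>b\<close>; the only
  one besides the identity is the transposition.
\<close>

lemma distinguishing_pair_partition_iff:
  assumes "a \<in> verts G" "b \<in> verts G" "a \<noteq> b"
  shows "distinguishing_partition G (pair_partition (verts G) a b) \<longleftrightarrow>
    transpose a b \<notin> automorphisms G"
proof
  assume dist: "distinguishing_partition G (pair_partition (verts G) a b)"
  have "\<forall>X\<in>pair_partition (verts G) a b. transpose a b ` X = X"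
    by (auto simp: pair_partition_def)
  then have "transpose a b \<in> automorphisms G \<Longrightarrow> transpose a b = id"
    using dist by (auto simp: distinguishing_partition_def)
  moreover have "transpose a b \<noteq> id"
    using assms(3) by (metis id_apply transpose_apply_first)
  ultimately show "transpose a b \<notin> automorphisms G" by blast
next
  assume transp: "transpose a b \<notin> automorphisms G"
  have "f = id" if f: "f \<in> automorphisms G"
    and fixed: "\<forall>X\<in>pair_partition (verts G) a b. f ` X = X" for f
  proof -
    have perm: "f permutes verts G" using f by (simp add: automorphisms_def)
    have "f x = x" if "x \<noteq> a" "x \<noteq> b" for x
      using that fixed permutes_not_in[OF perm] by (cases "x \<in> verts G") (auto simp: pair_partition_def)
    moreover have "f ` {a, b} = {a, b}" using fixed by (simp add: pair_partition_def)
    then have "f a = a \<and> f b = b \<or> f a = b \<and> f b = a"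
      by (auto simp: doubleton_eq_iff)
    ultimately have "(\<forall>x. f x = x) \<or> (\<forall>x. f x = transpose a b x)"
      unfolding transpose_def by metis
    then have "f = id \<or> f = transpose a b" by (simp add: fun_eq_iff)
    then show ?thesis using f transp by auto
  qed
  then show "distinguishing_partition G (pair_partition (verts G) a b)"
    using partition_on_pair_partition[OF assms(1,2)] by (auto simp: distinguishing_partition_def)
qed

section \<open>Distance and automorphisms of a cycle\<close>

text \<open>
  The graph distance in the cycle. It is expressed by the residue of the difference so that the
  invariance under translation and reflection modulo \<open>n\<close> (\<open>cyclic_dist_eqI\<close>) is immediate;
  \<open>cyclic_dist_le\<close> gives the form without residues for vertices below \<open>n\<close>.
\<close>

definition cyclic_dist :: "nat \<Rightarrow> nat \<Rightarrow> nat \<Rightarrow> nat" where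
  "cyclic_dist n x y = nat (min ((int x - int y) mod int n) ((int y - int x) mod int n))"

lemma cyclic_dist_commute: "cyclic_dist n x y = cyclic_dist n y x"
  by (simp add: cyclic_dist_def min.commute)

lemma cyclic_dist_le:
  assumes "x < y" "y < n"
  shows "cyclic_dist n x y = min (y - x) (n - (y - x))"
proof -
  have "(int x - int y) mod int n = (int x - int y + int n) mod int n" by simp
  also have "\<dots> = int x - int y + int n"
    using assms by (intro mod_pos_pos_trivial) auto
  finally have "(int x - int y) mod int n = int (n - (y - x))" using assms by simp
  moreover have "(int y - int x) mod int n = int (y - x)" using assms by simp
  ultimately show ?thesis
    by (simp only: cyclic_dist_def of_nat_min[symmetric] nat_int min.commute)
qed

lemma cyclic_dist_range:
  assumes "x < n" "y < n" "x \<noteq> y"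
  shows "cyclic_dist n x y \<in> {1..n div 2}"
proof -
  have "cyclic_dist n x y \<in> {1..n div 2}" if "x < y" "y < n" for x y
    using cyclic_dist_le[OF that] that by auto
  then show ?thesis
    using assms cyclic_dist_commute by (metis linorder_neqE_nat)
qed

lemma cyclic_dist_eqI:
  assumes "[int x' - int y' = s * (int x - int y)] (mod int n)" "s \<in> {1, -1}"
  shows "cyclic_dist n x' y' = cyclic_dist n x y"
proof -
  have "[int y' - int x' = s * (int y - int x)] (mod int n)"
    using cong_minus_minus_iff[THEN iffD2, OF assms(1)] by (simp add: algebra_simps)
  with assms show ?thesis
    by (auto simp: cyclic_dist_def cong_def min.commute)
qed

lemma verts_cycle_graph [simp]: "verts (cycle_graph n) = {..<n}"
  by (simp add: cycle_graph_def)

lemma edge_cycle_graph_iff: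
  assumes "n \<ge> 3" "x < n" "y < n"
  shows "{x, y} \<in> edges (cycle_graph n) \<longleftrightarrow>
    y = x + 1 \<or> x = y + 1 \<or> (x = 0 \<and> y = n - 1) \<or> (y = 0 \<and> x = n - 1)"
proof -
  have suc: "(i + 1) mod n = (if i = n - 1 then 0 else i + 1)" if "i < n" for i
    using that by auto
  have "{x, y} \<in> edges (cycle_graph n) \<longleftrightarrow> y = (x + 1) mod n \<or> x = (y + 1) mod n"
    using assms by (auto simp: cycle_graph_def doubleton_eq_iff)
  then show ?thesis
    unfolding suc[OF assms(2)] suc[OF assms(3)] using assms by auto
qed

lemma edge_cycle_graph_iff_dist:
  assumes "n \<ge> 3" "x < n" "y < n"
  shows "{x, y} \<in> edges (cycle_graph n) \<longleftrightarrow> cyclic_dist n x y = 1"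
proof -
  have "{x, y} \<in> edges (cycle_graph n) \<longleftrightarrow> cyclic_dist n x y = 1" if "x < y" "y < n" for x y
    using that assms(1) by (auto simp: edge_cycle_graph_iff cyclic_dist_le min_def)
  moreover have "{x, x} \<in> edges (cycle_graph n) \<longleftrightarrow> cyclic_dist n x x = 1" if "x < n" for x
    unfolding edge_cycle_graph_iff[OF assms(1) that that] using assms(1) by (auto simp: cyclic_dist_def)
  ultimately show ?thesis
    using assms(2,3) by (metis cyclic_dist_commute insert_commute linorder_neqE_nat)
qed

lemma edge_cycle_graph_cong:
  assumes "n \<ge> 3" "x < n" "y < n" "{x, y} \<in> edges (cycle_graph n)"
  shows "\<exists>s\<in>{1, -1}. [int y - int x = s] (mod int n)"
proof -
  have "y = x + 1 \<or> x = y + 1 \<or> (x = 0 \<and> y = n - 1) \<or> (y = 0 \<and> x = n - 1)"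
    using assms edge_cycle_graph_iff by blast
  then have "int y - int x \<in> {1, -1, int n - 1, 1 - int n}"
    using assms(1) by auto
  moreover have "[int n - 1 = -1] (mod int n)" "[1 - int n = 1] (mod int n)"
    by (simp_all add: cong_iff_dvd_diff)
  ultimately show ?thesis by auto
qed

text \<open>
  An automorphism maps the consecutive vertices \<open>i\<close> and \<open>i + 1\<close> to neighbours, so each step
  \<open>f (i + 1) - f i\<close> is \<open>1\<close> or \<open>-1\<close> modulo \<open>n\<close>. Two successive steps of opposite signs would give
  \<open>f (i + 2) = f i\<close>; injectivity therefore forces all steps to have the same sign.
\<close>

lemma automorphism_cycle_graph_affine:
  assumes n: "n \<ge> 3" and f: "f \<in> automorphisms (cycle_graph n)"
  obtains s :: int where "s \<in> {1, -1}"
    "\<And>i. i < n \<Longrightarrow> [int (f i) = int (f 0) + s * int i] (mod int n)"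
proof -
  have perm: "f permutes {..<n}" using f by (simp add: automorphisms_def)
  have lt: "f i < n" if "i < n" for i using permutes_in_image[OF perm] that by auto
  have step: "\<exists>s\<in>{1, -1}. [int (f (Suc i)) - int (f i) = s] (mod int n)" if "Suc i < n" for i
  proof (rule edge_cycle_graph_cong[OF n])
    have "{i, Suc i} \<in> edges (cycle_graph n)"
      using that n edge_cycle_graph_iff[of n i "Suc i"] by simp
    then show "{f i, f (Suc i)} \<in> edges (cycle_graph n)"
      using f that by (simp add: automorphisms_def)
  qed (use that lt in auto)
  obtain s where s: "s \<in> {1, -1}" "[int (f (Suc 0)) - int (f 0) = s] (mod int n)"
    using step[of 0] n by auto
  have same: "[int (f (Suc i)) - int (f i) = s] (mod int n)" if "Suc i < n" for i
    using that
  proof (induction i)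
    case 0
    then show ?case using s by simp
  next
    case (Suc i)
    obtain t where t: "t \<in> {1, -1}" "[int (f (Suc (Suc i))) - int (f (Suc i)) = t] (mod int n)"
      using step Suc.prems by blast
    have "t = s"
    proof (rule ccontr)
      assume "t \<noteq> s"
      then have "t + s = 0" using s(1) t(1) by auto
      then have "[int (f (Suc (Suc i))) - int (f i) = 0] (mod int n)"
        using cong_add[OF t(2) Suc.IH] Suc.prems by simp
      then have "[f (Suc (Suc i)) = f i] (mod n)"
        using cong_diff_iff_cong_0 cong_int_iff by blast
      then have "f (Suc (Suc i)) = f i"
        using lt Suc.prems by (metis Suc_lessD cong_less_modulus_unique_nat)
      then show False using permutes_inj[OF perm] by (simp add: inj_eq)
    qed
    then show ?case using t by simp
  qed
  have "[int (f i) = int (f 0) + s * int i] (mod int n)" if "i < n" for i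
    using that
  proof (induction i)
    case (Suc i)
    then have "[int (f i) + (int (f (Suc i)) - int (f i)) = int (f 0) + s * int i + s] (mod int n)"
      using same cong_add by (metis Suc_lessD)
    then show ?case by (simp add: algebra_simps)
  qed simp
  with s(1) show thesis using that by blast
qed

lemma automorphism_preserves_cyclic_dist:
  assumes "n \<ge> 3" "f \<in> automorphisms (cycle_graph n)" "x < n" "y < n"
  shows "cyclic_dist n (f x) (f y) = cyclic_dist n x y"
proof -
  obtain s :: int where s: "s \<in> {1, -1}"
    "\<And>i. i < n \<Longrightarrow> [int (f i) = int (f 0) + s * int i] (mod int n)"
    using automorphism_cycle_graph_affine assms(1,2) by blast
  have "[int (f x) - int (f y) = (int (f 0) + s * int x) - (int (f 0) + s * int y)] (mod int n)"
    using s(2) assms(3,4) by (intro cong_diff)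
  then show ?thesis
    using s(1) by (intro cyclic_dist_eqI[of _ _ s]) (simp_all add: algebra_simps)
qed

definition rotation :: "nat \<Rightarrow> nat \<Rightarrow> nat \<Rightarrow> nat" where
  "rotation n c x = (if x < n then (x + c) mod n else x)"

lemma cyclic_dist_rotation:
  assumes "x < n" "y < n"
  shows "cyclic_dist n (rotation n c x) (rotation n c y) = cyclic_dist n x y"
proof (rule cyclic_dist_eqI[of _ _ 1])
  show "[int (rotation n c x) - int (rotation n c y) = 1 * (int x - int y)] (mod int n)"
    using assms by (simp add: rotation_def zmod_int cong_def mod_diff_eq)
qed simp

lemma rotation_automorphism:
  assumes "n \<ge> 3"
  shows "rotation n c \<in> automorphisms (cycle_graph n)"
proof -
  have lt: "rotation n c x < n" if "x < n" for x
    using that by (simp add: rotation_def)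
  have "inj_on (rotation n c) {..<n}"
  proof (rule inj_onI)
    fix x y assume xy: "x \<in> {..<n}" "y \<in> {..<n}" "rotation n c x = rotation n c y"
    then have "[x + c = y + c] (mod n)" by (simp add: rotation_def cong_def)
    then have "[x = y] (mod n)" by (simp only: cong_add_rcancel_nat)
    then show "x = y" using xy by (auto intro: cong_less_modulus_unique_nat)
  qed
  moreover have "rotation n c ` {..<n} \<subseteq> {..<n}" using lt by auto
  ultimately have "bij_betw (rotation n c) {..<n} {..<n}"
    by (simp add: bij_betw_def endo_inj_surj)
  then have "rotation n c permutes {..<n}"
    by (rule bij_imp_permutes) (simp add: rotation_def)
  then show ?thesis
    using assms lt by (simp add: automorphisms_def edge_cycle_graph_iff_dist cyclic_dist_rotation)
qed

text \<open>
  If \<open>a\<close> and \<open>b\<close> could be exchanged, each neighbour \<open>a - 1\<close> and \<open>a + 1\<close> of \<open>a\<close> would be \<open>b\<close>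
  itself or a neighbour of \<open>b\<close>. So modulo \<open>n\<close>, \<open>b\<close> would be both one of \<open>a - 1, a - 2\<close> and one of
  \<open>a + 1, a + 2\<close>, which makes \<open>n\<close> a divisor of \<open>2\<close>, \<open>3\<close> or \<open>4\<close>. Only \<open>n = 4\<close> with
  \<open>b = a + 2\<close> is compatible with \<open>n \<ge> 4\<close>, and there \<open>a\<close> and \<open>b\<close> have distance 2.
\<close>

lemma transpose_not_automorphism_cycle_graph:
  assumes "n \<ge> 4" "a < n" "b < n" "a \<noteq> b" "n \<ge> 5 \<or> cyclic_dist n a b = 1"
  shows "transpose a b \<notin> automorphisms (cycle_graph n)"
proof
  assume aut: "transpose a b \<in> automorphisms (cycle_graph n)"
  have n: "n \<ge> 3" using assms(1) by simp
  have twin: "{b, w} \<in> edges (cycle_graph n)"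
    if "w < n" "w \<noteq> a" "w \<noteq> b" "{a, w} \<in> edges (cycle_graph n)" for w
  proof -
    have "{transpose a b a, transpose a b w} \<in> edges (cycle_graph n) \<longleftrightarrow>
        {a, w} \<in> edges (cycle_graph n)"
      using aut that(1) assms(2) unfolding automorphisms_def by (auto simp del: transpose_apply_first)
    then show ?thesis using that(2-4) by simp
  qed
  \<comment> \<open>The two neighbours of \<open>a\<close>; the case distinction below separates the positions where one of
    them wraps around.\<close>
  define p where "p = (if a = 0 then n - 1 else a - 1)"
  define q where "q = (if a = n - 1 then 0 else a + 1)"
  have pq: "p < n" "q < n" "p \<noteq> a" "q \<noteq> a" using assms by (auto simp: p_def q_def)
  have "{a, p} \<in> edges (cycle_graph n)" "{a, q} \<in> edges (cycle_graph n)"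
    unfolding edge_cycle_graph_iff[OF n assms(2) pq(1)] edge_cycle_graph_iff[OF n assms(2) pq(2)]
    using assms(2) by (auto simp: p_def q_def)
  then have near: "b = p \<or> {b, p} \<in> edges (cycle_graph n)" "b = q \<or> {b, q} \<in> edges (cycle_graph n)"
    using twin pq by blast+
  have four: "b = p \<or> b = q" if "n = 4"
  proof -
    have "{a, b} \<in> edges (cycle_graph n)"
      using that assms edge_cycle_graph_iff_dist[OF n assms(2,3)] by auto
    then show ?thesis
      using edge_cycle_graph_iff[OF n assms(2,3)] that assms(2,3) by (auto simp: p_def q_def)
  qed
  have large_or_near: "n \<ge> 5 \<or> n = 4 \<and> (b = p \<or> b = q)"
    using four assms(1) by linarith
  note edge_p = edge_cycle_graph_iff[OF n assms(3) pq(1)]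
  note edge_q = edge_cycle_graph_iff[OF n assms(3) pq(2)]
  consider "a = 0" | "a = n - 1" | "0 < a" "a < n - 1" using assms(2) by linarith
  then show False
  proof cases
    case 1
    then have p: "p = n - 1" and q: "q = 1" using n by (auto simp: p_def q_def)
    have "b = n - 1 \<or> b = n - 2"
      using near(1)[unfolded edge_p] assms(3,4) 1 n p by auto
    moreover have "b = 1 \<or> b = 2"
      using near(2)[unfolded edge_q] assms(3,4) 1 n q by auto
    ultimately show False using large_or_near p q by auto
  next
    case 2
    then have p: "p = n - 2" and q: "q = 0" using n by (auto simp: p_def q_def)
    have "b = n - 2 \<or> b = n - 3"
      using near(1)[unfolded edge_p] assms(3,4) 2 n p by auto
    moreover have "b = 0 \<or> b = 1"
      using near(2)[unfolded edge_q] assms(3,4) 2 n q by auto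
    ultimately show False using large_or_near p q by auto
  next
    case 3
    then have p: "p = a - 1" and q: "q = a + 1" by (auto simp: p_def q_def)
    have "b + 1 = a \<or> b + 2 = a \<or> a = 1 \<and> b = n - 1"
      using near(1)[unfolded edge_p] assms(3,4) 3 n p by auto
    moreover have "b = a + 1 \<or> b = a + 2 \<or> a = n - 2 \<and> b = 0"
      using near(2)[unfolded edge_q] assms(3,4) 3 n q by auto
    ultimately show False using large_or_near p q 3 by auto
  qed
qed

lemma edge_triangle_iff:
  assumes "x < 3" "y < 3"
  shows "{x, y} \<in> edges (cycle_graph 3) \<longleftrightarrow> x \<noteq> y"
proof -
  have "x = 0 \<or> x = 1 \<or> x = 2" "y = 0 \<or> y = 1 \<or> y = 2" using assms by linarith+
  then show ?thesis
    unfolding edge_cycle_graph_iff[OF order_refl assms] by (elim disjE; simp)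
qed

text \<open>
  The 4-cycle is the complete bipartite graph between its even and its odd vertices, so exchanging
  two vertices of equal parity preserves adjacency.
\<close>

lemma edge_square_iff:
  assumes "x < 4" "y < 4"
  shows "{x, y} \<in> edges (cycle_graph 4) \<longleftrightarrow> even x \<noteq> even y"
proof -
  have "(3::nat) \<le> 4" by simp
  note edge = edge_cycle_graph_iff[OF this assms]
  have "x = 0 \<or> x = 1 \<or> x = 2 \<or> x = 3" "y = 0 \<or> y = 1 \<or> y = 2 \<or> y = 3"
    using assms by linarith+
  then show ?thesis unfolding edge by (elim disjE; simp)
qed

lemma transpose_automorphism_cycle_graph:
  assumes "n = 3 \<or> n = 4 \<and> cyclic_dist n a b \<noteq> 1" "a < n" "b < n" "a \<noteq> b"
  shows "transpose a b \<in> automorphisms (cycle_graph n)"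
proof -
  have lt: "transpose a b x < n" if "x < n" for x
    using that assms(2,3) by (simp add: transpose_def)
  have "{transpose a b x, transpose a b y} \<in> edges (cycle_graph n) \<longleftrightarrow> {x, y} \<in> edges (cycle_graph n)"
    if "x < n" "y < n" for x y
  proof (cases "n = 3")
    case True
    then show ?thesis
      using lt[OF that(1)] lt[OF that(2)] that
      by (simp add: edge_triangle_iff inj_eq[OF inj_transpose])
  next
    case False
    then have 4: "n = 4" "cyclic_dist 4 a b \<noteq> 1" using assms(1) by auto
    then have "even a = even b"
      using edge_cycle_graph_iff_dist[of 4 a b] edge_square_iff[of a b] assms(2,3) by simp
    then have "even (transpose a b z) = even z" for z
      by (simp add: transpose_def)
    then show ?thesis
      using lt[OF that(1)] lt[OF that(2)] that 4(1) by (simp add: edge_square_iff)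
  qed
  moreover have "transpose a b permutes {..<n}"
    using assms by (intro permutes_swap_id) auto
  ultimately show ?thesis by (simp add: automorphisms_def)
qed

section \<open>Counting the equivalence classes\<close>

text \<open>
  For a partition with a single cell \<open>{a, b}\<close> of more than one vertex this is \<open>{cyclic_dist n a b}\<close>.
  Taking the set of all distances within cells gives a function of the partition itself and avoids
  choosing an order of \<open>a\<close> and \<open>b\<close>.
\<close>

definition cell_distances :: "nat \<Rightarrow> nat set set \<Rightarrow> nat set" where
  "cell_distances n P = {cyclic_dist n x y | x y. x \<noteq> y \<and> (\<exists>X\<in>P. x \<in> X \<and> y \<in> X)}"

lemma cell_distances_pair_partition:
  assumes "a \<noteq> b"
  shows "cell_distances n (pair_partition V a b) = {cyclic_dist n a b}"
  using assms cyclic_dist_commute[of n a b] by (fastforce simp: cell_distances_def pair_partition_def)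

text \<open>
  Automorphisms preserve the distance; conversely both partitions are rotations of the one whose
  two-element cell is \<open>{0, d}\<close>, where \<open>d\<close> is the common distance.
\<close>

lemma equiv_iff_cyclic_dist_eq:
  assumes n: "n \<ge> 3" and ab: "a < n" "b < n" "a \<noteq> b" and cd: "c < n" "d < n" "c \<noteq> d"
  shows "(pair_partition {..<n} a b, pair_partition {..<n} c d) \<in> partition_equiv (cycle_graph n)
    \<longleftrightarrow> cyclic_dist n a b = cyclic_dist n c d" (is "(?P, ?Q) \<in> ?E \<longleftrightarrow> _")
proof
  assume "(?P, ?Q) \<in> ?E"
  then obtain f where f: "f \<in> automorphisms (cycle_graph n)" "(\<lambda>X. f ` X) ` ?P = ?Q"
    by (auto simp: partition_equiv_def)
  have perm: "f permutes {..<n}" using f(1) by (simp add: automorphisms_def)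
  have "pair_partition {..<n} (f a) (f b) = ?Q"
    using f(2) image_pair_partition[OF perm] by metis
  moreover have "f a \<noteq> f b" using ab(3) permutes_inj[OF perm] by (simp add: inj_eq)
  ultimately have "cyclic_dist n (f a) (f b) = cyclic_dist n c d"
    using cd(3) cell_distances_pair_partition by (metis singleton_inject)
  then show "cyclic_dist n a b = cyclic_dist n c d"
    using automorphism_preserves_cyclic_dist[OF n f(1) ab(1,2)] by simp
next
  assume eq: "cyclic_dist n a b = cyclic_dist n c d"
  have normal: "(pair_partition {..<n} 0 (cyclic_dist n x y), pair_partition {..<n} x y) \<in> ?E"
    if "x < y" "y < n" for x y
  proof -
    let ?d = "cyclic_dist n x y"
    have d: "?d < n" using cyclic_dist_le[OF that] that by auto
    \<comment> \<open>The rotation moves 0 to the endpoint \<open>z\<close> from which \<open>d\<close> forward steps lead to the other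
      endpoint \<open>w\<close>: this is \<open>x\<close> if the shorter arc runs from \<open>x\<close> to \<open>y\<close>, and \<open>y\<close> if it wraps
      around.\<close>
    obtain z w where zw: "pair_partition {..<n} x y = pair_partition {..<n} z w" "z < n" "w = (?d + z) mod n"
    proof (cases "?d = y - x")
      case True
      then show thesis using that(1)[of x y] \<open>x < y\<close> \<open>y < n\<close> by simp
    next
      case False
      then have "?d + y = x + n" using cyclic_dist_le[OF \<open>x < y\<close> \<open>y < n\<close>] \<open>x < y\<close> \<open>y < n\<close> by linarith
      then show thesis
        using that(1)[of y x] \<open>x < y\<close> \<open>y < n\<close> pair_partition_commute[of "{..<n}" x y] by simp
    qed
    have "(\<lambda>X. rotation n z ` X) ` pair_partition {..<n} 0 ?d = pair_partition {..<n} x y"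
      using rotation_automorphism[OF n, of z] zw d n
      by (subst image_pair_partition) (auto simp: automorphisms_def rotation_def)
    then show ?thesis
      using rotation_automorphism[OF n, of z] that d n
      by (auto simp: partition_equiv_def intro!: partition_on_pair_partition)
  qed
  have normal': "(pair_partition {..<n} 0 (cyclic_dist n x y), pair_partition {..<n} x y) \<in> ?E"
    if "x < n" "y < n" "x \<noteq> y" for x y
    using normal[of x y] normal[of y x] that cyclic_dist_commute[of n x y]
      pair_partition_commute[of "{..<n}" x y] by (cases "x < y") auto
  have "sym ?E" "trans ?E"
    using equiv_partition_equiv[of "cycle_graph n"] by (auto elim: equivE)
  then show "(?P, ?Q) \<in> ?E"
    using normal'[OF ab] normal'[OF cd] eq by (metis symD transD)
qed

text \<open>
  If \<open>h\<close> is a complete invariant of \<open>R\<close> on \<open>A\<close>, then the classes are the nonempty fibres of \<open>h\<close>.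
\<close>

lemma card_quotient_eq_card_image:
  assumes "\<And>x y. x \<in> A \<Longrightarrow> y \<in> A \<Longrightarrow> (x, y) \<in> R \<longleftrightarrow> h x = h y"
  shows "card (A // Restr R A) = card (h ` A)"
proof -
  have "A // Restr R A = (\<lambda>x. {y \<in> A. h y = h x}) ` A"
    using assms by (fastforce simp: quotient_def)
  also have "\<dots> = (\<lambda>v. {y \<in> A. h y = v}) ` h ` A" by (simp add: image_image)
  also have "card \<dots> = card (h ` A)"
    by (intro card_image) (auto simp: inj_on_def)
  finally show ?thesis .
qed

lemma distinguishing_partitions_cycle_graph:
  assumes n: "n \<ge> 3"
  shows "distinguishing_partitions (cycle_graph n) (n - 1) =
    {pair_partition {..<n} a b | a b. a < n \<and> b < n \<and> a \<noteq> b \<and>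
      (n \<ge> 5 \<or> n = 4 \<and> cyclic_dist n a b = 1)}" (is "?D = ?S")
proof -
  have dist: "distinguishing_partition (cycle_graph n) (pair_partition {..<n} a b) \<longleftrightarrow>
      n \<ge> 5 \<or> n = 4 \<and> cyclic_dist n a b = 1" if "a < n" "b < n" "a \<noteq> b" for a b
  proof (cases "n \<ge> 5 \<or> n = 4 \<and> cyclic_dist n a b = 1")
    case True
    then show ?thesis
      using distinguishing_pair_partition_iff[of a "cycle_graph n" b]
        transpose_not_automorphism_cycle_graph[of n a b] that by auto
  next
    case False
    then have "n = 3 \<or> n = 4 \<and> cyclic_dist n a b \<noteq> 1" using n by force
    then have "transpose a b \<in> automorphisms (cycle_graph n)"
      using transpose_automorphism_cycle_graph that by blast
    then show ?thesis
      using distinguishing_pair_partition_iff[of a "cycle_graph n" b] that False by auto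
  qed
  show ?thesis
  proof
    show "?D \<subseteq> ?S"
    proof
      fix P assume "P \<in> ?D"
      then have P: "distinguishing_partition (cycle_graph n) P" "card P = n - 1"
        by (auto simp: distinguishing_partitions_def)
      then have "partition_on {..<n} P" by (simp add: distinguishing_partition_def)
      then obtain a b where "a < n" "b < n" "a \<noteq> b" "P = pair_partition {..<n} a b"
        using P(2) n by (elim partition_with_one_cell_fewer[rotated]) auto
      then show "P \<in> ?S" using P(1) dist by blast
    qed
    show "?S \<subseteq> ?D"
    proof
      fix P assume "P \<in> ?S"
      then obtain a b where ab: "P = pair_partition {..<n} a b" "a < n" "b < n" "a \<noteq> b"
        and "n \<ge> 5 \<or> n = 4 \<and> cyclic_dist n a b = 1" by blast
      then have "distinguishing_partition (cycle_graph n) P" using dist by simp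
      moreover have "finite P" using ab by (simp add: pair_partition_def)
      ultimately show "P \<in> ?D"
        using ab card_pair_partition[of "{..<n}" a b] by (simp add: distinguishing_partitions_def)
    qed
  qed
qed

lemma psi_cycle_graph:
  assumes n: "n \<ge> 3"
  shows "psi (n - 1) (cycle_graph n) = card {d \<in> {1..n div 2}. n \<ge> 5 \<or> n = 4 \<and> d = 1}"
    (is "_ = card ?I")
proof -
  let ?D = "distinguishing_partitions (cycle_graph n) (n - 1)"
  note D = distinguishing_partitions_cycle_graph[OF n]
  have "psi (n - 1) (cycle_graph n) = card (cell_distances n ` ?D)"
    unfolding psi_def
  proof (rule card_quotient_eq_card_image)
    fix P Q assume "P \<in> ?D" "Q \<in> ?D"
    then show "(P, Q) \<in> partition_equiv (cycle_graph n) \<longleftrightarrow> cell_distances n P = cell_distances n Q"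
      unfolding D using equiv_iff_cyclic_dist_eq[OF n] cell_distances_pair_partition by fastforce
  qed
  also have "cell_distances n ` ?D = (\<lambda>d. {d}) ` ?I"
  proof
    show "cell_distances n ` ?D \<subseteq> (\<lambda>d. {d}) ` ?I"
    proof
      fix v assume "v \<in> cell_distances n ` ?D"
      then obtain a b where "a < n" "b < n" "a \<noteq> b" "v = {cyclic_dist n a b}"
        "n \<ge> 5 \<or> n = 4 \<and> cyclic_dist n a b = 1"
        unfolding D using cell_distances_pair_partition by fastforce
      then show "v \<in> (\<lambda>d. {d}) ` ?I" using cyclic_dist_range by blast
    qed
    show "(\<lambda>d. {d}) ` ?I \<subseteq> cell_distances n ` ?D"
    proof clarify
      fix d assume d: "d \<in> {1..n div 2}" "n \<ge> 5 \<or> n = 4 \<and> d = 1"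
      then have lt: "0 < d" "d < n" by auto
      have dist: "cyclic_dist n 0 d = d" using cyclic_dist_le[OF lt] d by auto
      then have "pair_partition {..<n} 0 d \<in> ?D" unfolding D using d(2) lt by fastforce
      moreover have "cell_distances n (pair_partition {..<n} 0 d) = {d}"
        using cell_distances_pair_partition[of 0 d] lt dist by simp
      ultimately show "{d} \<in> cell_distances n ` ?D" by force
    qed
  qed
  also have "card \<dots> = card ?I" by (intro card_image) (auto simp: inj_on_def)
  finally show ?thesis .
qed

theorem proposition4p3:
  fixes n :: nat
  assumes "n \<ge> 3"
  shows "(n = 3 \<longrightarrow> psi (n - 1) (cycle_graph n) = 0) \<and>
         (n = 4 \<longrightarrow> psi (n - 1) (cycle_graph n) = 1) \<and>
         (n \<ge> 5 \<longrightarrow> psi (n - 1) (cycle_graph n) = n div 2)"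
proof -
  have "{d \<in> {1..n div 2}. n \<ge> 5 \<or> n = 4 \<and> d = 1} =
      (if n \<ge> 5 then {1..n div 2} else if n = 4 then {1} else {})" by auto
  then have "psi (n - 1) (cycle_graph n) = (if n \<ge> 5 then n div 2 else if n = 4 then 1 else 0)"
    unfolding psi_cycle_graph[OF assms] by simp
  then show ?thesis by (auto simp del: One_nat_def)
qed

end
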